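(* Consider an MDP-JLS with ergodic unichain MDP $\mathcal{M}=(S,\hat{s},\Sigma,T)$ and mode matrices $A_s\in\mathbb{R}^{n\times n}$, $s\in S$. For each $s\in S$ let $0<\alpha_s<1$ and $\mu_s>1$ be mode-dependent stability constants, i.e. there is a Lyapunov function candidate $\{V_s : s\in S\}$ with $V_s(A_sx)-V_s(x)\le-\alpha_s V_s(x)$ and $V_s(x)\le\mu_s V_{s'}(x)$ for all $s,s'\in S$, $x\in\mathbb{R}^n$. Let $\epsilon>0$ be small and $c:S\to\mathbb{R}$ an optimization criterion. Consider the linear optimization problem in the variables $\hat\pi\in\mathbb{R}^{|S|\times|\Sigma|}$, $p^\infty\in\mathbb{R}^{|S|}$, $\hat P\in\mathbb{R}^{|S|\times|S|}$: $$\begin{aligned}\text{minimize}\quad&\sum_{s}c(s)p_s^\infty\\ \text{subject to}\quad&\hat\pi\mathbf 1=p^\infty,\quad \mathbf 1'p^\infty=1,\quad \hat P'\mathbf 1=p^\infty,\\ &\hat P_{ij}=\sum_{\sigma}T(i,\sigma,j)\hat\pi(i,\sigma)\quad\forall i,j\in S,\\ &\sum_i\left[\Big(\sum_{j\ne i}\hat P_{ji}\Big)\ln(\mu_i)+p_i^\infty\ln(1-\alpha_i)\right]<0,\\ &\hat\pi\ge0,\quad p^\infty\ge\epsilon,\end{aligned}$$ where the last two inequalities are entrywise. If $(\hat\pi_{opt},p^\infty_{opt},\hat P_{opt})$ is an optimal solution, then $$\pi=\mathrm{diag}(p^\infty_{opt})^{-1}\hat\pi_{opt},\qquad P=\mathrm{diag}(p^\infty_{opt})^{-1}\hat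 P_{opt},\qquad p^\infty=p^\infty_{opt}$$ are respectively a policy of $\mathcal{M}$, the transition matrix of the DTMC induced by $\pi$, and the stationary distribution of that DTMC, and the MJLS induced by $\pi$ is stable with probability one.
   Context: An MDP is a tuple $\mathcal{M}=(S,\hat{s},\Sigma,T)$ with finite state set $S$, initial state $\hat s\in S$, finite action set $\Sigma$, and transition function $T(s,\sigma,s')=p(s'|s,\sigma)$ (states are indexed, $T(i,\sigma,j)=T(s_i,\sigma,s_j)$, $\alpha_i=\alpha_{s_i}$, $\mu_i=\mu_{s_i}$). If $\sigma$ is available at $s$ then $T(s,\sigma,\cdot)$ is a probability distribution; otherwise $T(s,\sigma,\cdot)=0$ and policies do not select $\sigma$ at $s$. A policy $\pi:S\times\Sigma\to[0,1]$ gives the probability $\pi(s,\sigma)$ of taking action $\sigma$ at $s$. Under $\pi$ the MDP reduces to a discrete-time Markov chain (DTMC) $(S,\hat s,P)$ with $P_{ij}=\sum_{\sigma}T(i,\sigma,j)\pi(i,\sigma)$. A DTMC is an ergodic unichain if it has a single ergodic class (communicating class of recurrent aperiodic states) and possibly some transient states; an MDP is an ergodic unichain if every policy induces an ergodic unichain DTMC (so the stationary distribution exists and is unique). An MDP-JLS is the switched system $x(k+1)=A_{s_k}x(k)$, $x(k)\in\mathbb{R}^n$, where $s_k\in S$ is the mode at time $k$, with the mode process governed by $\mathcal{M}$. Given a policy it becomes a Markov jump linear system (MJLS): the modes follow the induced DTMC. An MJLS is stable with probability one if, for any initial condition $x_0$, $\lim_{k\to\infty}\|x(k)\|_\infty=0$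 with probability one. Lyapunov function candidate: each $V_s:\mathbb{R}^n\to\mathbb{R}$ is continuous, radially unbounded, $V_s(0)=0$ and $V_s(x)>0$ for $x\ne0$. $\mathbf 1$ is the all-ones column vector of suitable dimension, $'$ is transpose, and $\mathrm{diag}(v)$ is the diagonal matrix with diagonal $v$. *)

theory Defs
  imports "HOL-Probability.Probability"
begin

section \<open>Markov decision processes\<close>

text \<open>
  The finite state set and the finite action set are finite types \<open>'s\<close> and \<open>'a\<close>.
  Unavailable actions are those with a vanishing transition row.
\<close>

definition available :: "('s \<Rightarrow> 'a \<Rightarrow> 's \<Rightarrow> real) \<Rightarrow> 's \<Rightarrow> 'a \<Rightarrow> bool" where
  "available T s \<sigma> \<longleftrightarrow> (\<exists>s'. T s \<sigma> s' \<noteq> 0)"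

definition mdp :: "('s::finite \<Rightarrow> 'a::finite \<Rightarrow> 's \<Rightarrow> real) \<Rightarrow> bool" where
  "mdp T \<longleftrightarrow>
    (\<forall>s \<sigma>. available T s \<sigma> \<longrightarrow> (\<forall>s'. 0 \<le> T s \<sigma> s') \<and> (\<Sum>s'\<in>UNIV. T s \<sigma> s') = 1)"

definition policy :: "('s::finite \<Rightarrow> 'a::finite \<Rightarrow> 's \<Rightarrow> real) \<Rightarrow> real^'a^'s \<Rightarrow> bool" where
  "policy T \<pi> \<longleftrightarrow>
    (\<forall>s \<sigma>. 0 \<le> \<pi> $ s $ \<sigma> \<and> \<pi> $ s $ \<sigma> \<le> 1) \<and>
    (\<forall>s. (\<Sum>\<sigma>\<in>UNIV. \<pi> $ s $ \<sigma>) = 1) \<and>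
    (\<forall>s \<sigma>. \<not> available T s \<sigma> \<longrightarrow> \<pi> $ s $ \<sigma> = 0)"

definition induced_matrix ::
  "('s::finite \<Rightarrow> 'a::finite \<Rightarrow> 's \<Rightarrow> real) \<Rightarrow> real^'a^'s \<Rightarrow> real^'s^'s" where
  "induced_matrix T \<pi> = (\<chi> i j. \<Sum>\<sigma>\<in>UNIV. T i \<sigma> j * \<pi> $ i $ \<sigma>)"


section \<open>Finite discrete-time Markov chains\<close>

definition stochastic_matrix :: "real^'s^'s \<Rightarrow> bool" where
  "stochastic_matrix P \<longleftrightarrow> (\<forall>i j. 0 \<le> P $ i $ j) \<and> (\<forall>i. (\<Sum>j\<in>UNIV. P $ i $ j) = 1)"

text \<open>The overloaded power would be taken entrywise on type \<open>real^'s^'s\<close>.\<close>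

definition mat_power :: "real^'s^'s \<Rightarrow> nat \<Rightarrow> real^'s^'s" where
  "mat_power P k = (((**) P) ^^ k) (mat 1)"

definition accessible :: "real^'s^'s \<Rightarrow> 's \<Rightarrow> 's \<Rightarrow> bool" where
  "accessible P i j \<longleftrightarrow> (\<exists>k. 0 < mat_power P k $ i $ j)"

definition communicating_class :: "real^'s^'s \<Rightarrow> 's set \<Rightarrow> bool" where
  "communicating_class P C \<longleftrightarrow>
    C \<in> UNIV // {(i, j). accessible P i j \<and> accessible P j i}"

text \<open>
  \<open>first_passage P j k i\<close> is the probability that the chain started in \<open>i\<close> visits \<open>j\<close>
  at time \<open>k + 1\<close> and at none of the times \<open>1, \<dots>, k\<close>.
\<close>

primrec first_passage :: "real^'s^'s \<Rightarrow> 's \<Rightarrow> nat \<Rightarrow> 's \<Rightarrow> real" where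
  "first_passage P j 0 i = P $ i $ j"
| "first_passage P j (Suc k) i = (\<Sum>l\<in>UNIV - {j}. P $ i $ l * first_passage P j k l)"

definition recurrent :: "real^'s^'s \<Rightarrow> 's \<Rightarrow> bool" where
  "recurrent P i \<longleftrightarrow> (\<lambda>k. first_passage P i k i) sums 1"

definition aperiodic :: "real^'s^'s \<Rightarrow> 's \<Rightarrow> bool" where
  "aperiodic P i \<longleftrightarrow> Gcd {k. 0 < k \<and> 0 < mat_power P k $ i $ i} = 1"

definition ergodic_class :: "real^'s^'s \<Rightarrow> 's set \<Rightarrow> bool" where
  "ergodic_class P C \<longleftrightarrow>
    communicating_class P C \<and> (\<forall>i\<in>C. recurrent P i \<and> aperiodic P i)"

definition ergodic_unichain :: "real^'s^'s \<Rightarrow> bool" where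
  "ergodic_unichain P \<longleftrightarrow> (\<exists>C. ergodic_class P C \<and> (\<forall>i. i \<notin> C \<longrightarrow> \<not> recurrent P i))"

definition ergodic_unichain_mdp :: "('s::finite \<Rightarrow> 'a::finite \<Rightarrow> 's \<Rightarrow> real) \<Rightarrow> bool" where
  "ergodic_unichain_mdp T \<longleftrightarrow>
    mdp T \<and> (\<forall>\<pi>. policy T \<pi> \<longrightarrow> ergodic_unichain (induced_matrix T \<pi>))"

definition stationary_distribution :: "real^'s^'s \<Rightarrow> real^'s \<Rightarrow> bool" where
  "stationary_distribution P q \<longleftrightarrow>
    (\<forall>i. 0 \<le> q $ i) \<and> (\<Sum>i\<in>UNIV. q $ i) = 1 \<and> q v* P = q"

text \<open>
  A random process \<open>X\<close> on the sample space \<open>M\<close> is the chain \<open>(S, s0, P)\<close>: it starts in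
  \<open>s0\<close>, and given any history up to time \<open>k\<close> the next state is drawn from the row of
  \<open>P\<close> at the current state. The conditioning is written multiplicatively, which also covers
  histories of probability zero.
\<close>

definition dtmc_process ::
  "'w measure \<Rightarrow> (nat \<Rightarrow> 'w \<Rightarrow> 's::finite) \<Rightarrow> 's \<Rightarrow> real^'s^'s \<Rightarrow> bool" where
  "dtmc_process M X s0 P \<longleftrightarrow>
    prob_space M \<and>
    (\<forall>k. X k \<in> M \<rightarrow>\<^sub>M count_space UNIV) \<and>
    (AE w in M. X 0 w = s0) \<and>
    (\<forall>k h j.
      measure M {w \<in> space M. (\<forall>t\<le>k. X t w = h t) \<and> X (Suc k) w = j} =
      measure M {w \<in> space M. \<forall>t\<le>k. X t w = h t} * P $ (h k) $ j)"

text \<open>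
  Every stochastic matrix is realised by such a process: apply i.i.d. random self-maps of the
  state set, whose values at a state \<open>i\<close> are distributed according to row \<open>i\<close> of \<open>P\<close>.
\<close>

primrec chain_of_maps :: "'s \<Rightarrow> nat \<Rightarrow> (nat \<Rightarrow> 's \<Rightarrow> 's) \<Rightarrow> 's" where
  "chain_of_maps s0 0 w = s0"
| "chain_of_maps s0 (Suc k) w = w k (chain_of_maps s0 k w)"

lemma chain_of_maps_history:
  "(\<forall>t\<le>k. chain_of_maps s0 t w = h t) \<longleftrightarrow> h 0 = s0 \<and> (\<forall>t<k. w t (h t) = h (Suc t))"
proof (induction k)
  case 0 then show ?case by auto
next
  case (Suc k)
  have "(\<forall>t\<le>Suc k. chain_of_maps s0 t w = h t) \<longleftrightarrow>
     (\<forall>t\<le>k. chain_of_maps s0 t w = h t) \<and> chain_of_maps s0 (Suc k) w = h (Suc k)"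
    by (auto simp: le_Suc_eq)
  also have "\<dots> \<longleftrightarrow> (\<forall>t\<le>k. chain_of_maps s0 t w = h t) \<and> w k (h k) = h (Suc k)"
    by auto
  finally show ?case using Suc by (auto simp: less_Suc_eq)
qed

lemma dtmc_process_exists:
  fixes P :: "real^'s^'s"
  assumes stoch: "stochastic_matrix P"
  shows "\<exists>(M :: (nat \<Rightarrow> 's \<Rightarrow> 's) measure) X. dtmc_process M X s0 P"
proof -
  define K where "K i = embed_pmf (\<lambda>j. P $ i $ j)" for i
  have K: "pmf (K i) j = P $ i $ j" for i j
    unfolding K_def using stoch
    by (subst pmf_embed_pmf) (auto simp: stochastic_matrix_def nn_integral_count_space_finite sum_ennreal)
  define Q where "Q = Pi_pmf UNIV undefined K"
  have Q: "measure (measure_pmf Q) {f. f i = j} = P $ i $ j" for i j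
  proof -
    have "map_pmf (\<lambda>f. f i) Q = K i" unfolding Q_def by (subst Pi_pmf_component) auto
    then have "pmf (map_pmf (\<lambda>f. f i) Q) j = P $ i $ j" using K by simp
    then show ?thesis by (simp add: pmf_map vimage_def)
  qed
  define M where "M = Pi\<^sub>M (UNIV :: nat set) (\<lambda>_. measure_pmf Q)"
  interpret product_prob_space "\<lambda>_. measure_pmf Q" "UNIV :: nat set" ..
  have cyl: "measure M {w \<in> space M. \<forall>t<k. w t (g t) = g' t} = (\<Prod>t<k. P $ g t $ g' t)" for k g g'
  proof -
    have nonneg: "0 \<le> P $ i $ j" for i j
      using stoch by (simp add: stochastic_matrix_def)
    have "ennreal (measure M {w \<in> space M. \<forall>t<k. w t (g t) = g' t}) =
        (\<Prod>t<k. ennreal (P $ g t $ g' t))"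
      using emeasure_PiM_Collect[of "{..<k}" "\<lambda>t. {f. f (g t) = g' t}"]
      unfolding M_def emeasure_eq_measure measure_pmf.emeasure_eq_measure
      by (simp add: Q Ball_def)
    also have "\<dots> = ennreal (\<Prod>t<k. P $ g t $ g' t)"
      by (rule prod_ennreal) (rule nonneg)
    finally show ?thesis
      by (simp add: nonneg prod_nonneg)
  qed
  have meas: "chain_of_maps s0 k \<in> M \<rightarrow>\<^sub>M count_space UNIV" for k
  proof (induction k)
    case (Suc k)
    have c: "(\<lambda>w. w k) \<in> M \<rightarrow>\<^sub>M count_space UNIV"
      unfolding M_def by (rule measurable_compose[OF measurable_component_singleton[of k UNIV "\<lambda>_. measure_pmf Q"]]) auto
    show ?case
      using measurable_compose_countable[of "\<lambda>s w. w k s", OF measurable_compose[OF c] Suc]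
      by simp
  qed simp
  have hist: "measure M {w \<in> space M. \<forall>t\<le>k. chain_of_maps s0 t w = h t}
      = (if h 0 = s0 then \<Prod>t<k. P $ h t $ h (Suc t) else 0)" for k h
    using cyl[of k h "\<lambda>t. h (Suc t)"] by (simp add: chain_of_maps_history)
  have "measure M {w \<in> space M. (\<forall>t\<le>k. chain_of_maps s0 t w = h t) \<and> chain_of_maps s0 (Suc k) w = j}
      = measure M {w \<in> space M. \<forall>t\<le>k. chain_of_maps s0 t w = h t} * P $ h k $ j" for k h j
  proof -
    have "{w \<in> space M. (\<forall>t\<le>k. chain_of_maps s0 t w = h t) \<and> chain_of_maps s0 (Suc k) w = j}
      = {w \<in> space M. \<forall>t\<le>Suc k. chain_of_maps s0 t w = (h(Suc k := j)) t}"
      by (auto simp: le_Suc_eq simp del: chain_of_maps.simps)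
    then show ?thesis by (simp add: hist del: chain_of_maps.simps)
  qed
  moreover have "prob_space M" unfolding M_def by (rule prob_space_axioms)
  ultimately have "dtmc_process M (chain_of_maps s0) s0 P"
    using meas by (simp add: dtmc_process_def)
  then show ?thesis by blast
qed

section \<open>Markov jump linear systems\<close>

primrec jls_state ::
  "('s \<Rightarrow> real^'n^'n) \<Rightarrow> (nat \<Rightarrow> 's) \<Rightarrow> real^'n \<Rightarrow> nat \<Rightarrow> real^'n" where
  "jls_state A m x0 0 = x0"
| "jls_state A m x0 (Suc k) = A (m k) *v jls_state A m x0 k"

text \<open>On \<open>real^'n\<close>, \<open>infnorm\<close> is the maximum norm.\<close>

definition stable_wp1 ::
  "'w measure \<Rightarrow> (nat \<Rightarrow> 'w \<Rightarrow> 's) \<Rightarrow> ('s \<Rightarrow> real^'n^'n) \<Rightarrow> bool" where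
  "stable_wp1 M X A \<longleftrightarrow>
    (\<forall>x0. AE w in M. (\<lambda>k. infnorm (jls_state A (\<lambda>k. X k w) x0 k)) \<longlonglongrightarrow> 0)"

definition lyapunov_candidate :: "('s \<Rightarrow> real^'n \<Rightarrow> real) \<Rightarrow> bool" where
  "lyapunov_candidate V \<longleftrightarrow>
    (\<forall>s. continuous_on UNIV (V s) \<and> filterlim (V s) at_top at_infinity \<and>
         V s 0 = 0 \<and> (\<forall>x. x \<noteq> 0 \<longrightarrow> 0 < V s x))"

definition stability_constants ::
  "('s \<Rightarrow> real^'n^'n) \<Rightarrow> ('s \<Rightarrow> real) \<Rightarrow> ('s \<Rightarrow> real) \<Rightarrow> bool" where
  "stability_constants A \<alpha> \<mu> \<longleftrightarrow>
    (\<forall>s. 0 < \<alpha> s \<and> \<alpha> s < 1 \<and> 1 < \<mu> s) \<and>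
    (\<exists>V. lyapunov_candidate V \<and>
      (\<forall>s x. V s (A s *v x) - V s x \<le> - \<alpha> s * V s x) \<and>
      (\<forall>s s' x. V s x \<le> \<mu> s * V s' x))"


section \<open>The linear optimization problem\<close>

definition diag :: "real^'s \<Rightarrow> real^'s^'s" where
  "diag v = (\<chi> i j. if i = j then v $ i else 0)"

text \<open>The vector \<open>1 :: real^'k\<close> is the all-ones vector.\<close>

definition lp_feasible ::
  "('s::finite \<Rightarrow> 'a::finite \<Rightarrow> 's \<Rightarrow> real) \<Rightarrow> ('s \<Rightarrow> real) \<Rightarrow> ('s \<Rightarrow> real) \<Rightarrow> real \<Rightarrow>
   real^'a^'s \<Rightarrow> real^'s \<Rightarrow> real^'s^'s \<Rightarrow> bool" where
  "lp_feasible T \<alpha> \<mu> \<epsilon> \<pi>h p Ph \<longleftrightarrow>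
    \<pi>h *v 1 = p \<and>
    1 \<bullet> p = 1 \<and>
    transpose Ph *v 1 = p \<and>
    (\<forall>i j. Ph $ i $ j = (\<Sum>\<sigma>\<in>UNIV. T i \<sigma> j * \<pi>h $ i $ \<sigma>)) \<and>
    (\<Sum>i\<in>UNIV. (\<Sum>j\<in>UNIV - {i}. Ph $ j $ i) * ln (\<mu> i) + p $ i * ln (1 - \<alpha> i)) < 0 \<and>
    (\<forall>i \<sigma>. 0 \<le> \<pi>h $ i $ \<sigma>) \<and>
    (\<forall>i. \<epsilon> \<le> p $ i)"

definition lp_objective :: "('s::finite \<Rightarrow> real) \<Rightarrow> real^'s \<Rightarrow> real" where
  "lp_objective c p = (\<Sum>s\<in>UNIV. c s * p $ s)"

definition lp_optimal ::
  "('s::finite \<Rightarrow> 'a::finite \<Rightarrow> 's \<Rightarrow> real) \<Rightarrow> ('s \<Rightarrow> real) \<Rightarrow> ('s \<Rightarrow> real) \<Rightarrow> real \<Rightarrow>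
   ('s \<Rightarrow> real) \<Rightarrow> real^'a^'s \<Rightarrow> real^'s \<Rightarrow> real^'s^'s \<Rightarrow> bool" where
  "lp_optimal T \<alpha> \<mu> \<epsilon> c \<pi>h p Ph \<longleftrightarrow>
    lp_feasible T \<alpha> \<mu> \<epsilon> \<pi>h p Ph \<and>
    (\<forall>\<pi>h' p' Ph'. lp_feasible T \<alpha> \<mu> \<epsilon> \<pi>h' p' Ph' \<longrightarrow> lp_objective c p \<le> lp_objective c p')"

end

theory Submission
  imports Defs
begin

text \<open>
  A stationary distribution \<open>p\<close> with positive entries forces every state to be recurrent, so
  the unichain hypothesis makes the chain irreducible and \<open>p\<close> spans the invariant vectors.

  For stability, \<open>V\<close> at time \<open>k\<close> is at most \<open>V\<close> at time \<open>0\<close> times \<open>exp (g\<^sub>1 + \<dots> + g\<^sub>k)\<close>, where the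
  cost \<open>g\<close> of a transition \<open>i \<rightarrow> j\<close> is \<open>ln (1 - \<alpha> i)\<close>, plus \<open>ln (\<mu> j)\<close> if \<open>j \<noteq> i\<close>. The linear
  inequality says that \<open>g\<close> has a negative stationary mean. Instead of the ergodic theorem we use
  that a solution \<open>u\<close> of the Poisson equation turns this into a negative one-step drift from every
  state, so that, for small \<open>\<theta> > 0\<close>, \<open>exp (\<theta> (g\<^sub>1 + \<dots> + g\<^sub>k + u))\<close> has geometrically decaying
  expectation. Hence it is summable, and tends to \<open>0\<close>, almost surely.
\<close>

section \<open>Invariant vectors of a finite unichain\<close>

text \<open>Averaging the first-step equation of the return probability \<open>h\<close> against \<open>p\<close> cancels all
  terms but \<open>p $ j * h j = p $ j\<close>.\<close>

lemma stationary_recurrent: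
  fixes P :: "real^'s::finite^'s"
  assumes st: "stochastic_matrix P" and p: "\<And>i. 0 < p $ i" and inv: "p v* P = p"
  shows "recurrent P j"
proof -
  have nn: "0 \<le> P $ i $ l" and row: "(\<Sum>l\<in>UNIV. P $ i $ l) = 1" for i l
    using st by (auto simp: stochastic_matrix_def)
  have f0: "0 \<le> first_passage P j k i" for k i
    by (induction k arbitrary: i) (auto intro!: sum_nonneg mult_nonneg_nonneg nn)
  \<comment> \<open>\<open>F n i\<close> is the probability of visiting \<open>j\<close> at one of
    the times \<open>1, ..., n\<close>. The first-step recursion is proved for these partial sums
    first: it bounds them by \<open>1\<close>, which gives the summability needed to pass to the
    limit \<open>h\<close>.\<close>
  define F where "F n i = (\<Sum>k<n. first_passage P j k i)" for n i
  have F_Suc: "F (Suc n) i = P $ i $ j + (\<Sum>l\<in>UNIV - {j}. P $ i $ l * F n l)" for n i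
    unfolding F_def
    by (subst sum.lessThan_Suc_shift) (simp add: sum_distrib_left sum.swap[of _ _ "{..<n}"])
  have F_le: "F n i \<le> 1" for n i
  proof (induction n arbitrary: i)
    case 0 then show ?case by (simp add: F_def)
  next
    case (Suc n)
    have "F (Suc n) i \<le> P $ i $ j + (\<Sum>l\<in>UNIV - {j}. P $ i $ l)"
      unfolding F_Suc by (intro add_left_mono sum_mono mult_left_le Suc nn)
    also have "\<dots> = 1"
      using row[of i] by (simp add: sum.remove[of UNIV j])
    finally show ?case .
  qed
  have summ: "summable (\<lambda>k. first_passage P j k i)" for i
    by (rule summableI_nonneg_bounded[of _ 1]) (use f0 F_le in \<open>auto simp: F_def\<close>)
  define h where "h i = (\<Sum>k. first_passage P j k i)" for i
  have F_lim: "(\<lambda>n. F n i) \<longlonglongrightarrow> h i" for i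
    unfolding F_def h_def by (rule summable_LIMSEQ[OF summ])
  have h_eq: "h i = P $ i $ j + (\<Sum>l\<in>UNIV - {j}. P $ i $ l * h l)" for i
  proof (rule LIMSEQ_unique)
    show "(\<lambda>n. F (Suc n) i) \<longlonglongrightarrow> h i"
      by (rule LIMSEQ_Suc[OF F_lim])
    show "(\<lambda>n. F (Suc n) i) \<longlonglongrightarrow> P $ i $ j + (\<Sum>l\<in>UNIV - {j}. P $ i $ l * h l)"
      unfolding F_Suc by (intro tendsto_intros F_lim)
  qed
  have col: "(\<Sum>i\<in>UNIV. p $ i * P $ i $ l) = p $ l" for l
    using inv by (simp add: vector_matrix_mult_def vec_eq_iff)
  have "(\<Sum>i\<in>UNIV. p $ i * h i)
      = (\<Sum>i\<in>UNIV. p $ i * P $ i $ j) + (\<Sum>i\<in>UNIV. \<Sum>l\<in>UNIV - {j}. p $ i * P $ i $ l * h l)"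
    by (subst h_eq) (simp add: distrib_left sum.distrib sum_distrib_left mult.assoc)
  also have "\<dots> = p $ j + (\<Sum>l\<in>UNIV - {j}. p $ l * h l)"
    by (subst sum.swap) (simp add: col flip: sum_distrib_right)
  finally have "p $ j * h j = p $ j"
    by (simp add: sum.remove[of UNIV j])
  then have "h j = 1"
    using p[of j] by simp
  then show ?thesis
    using summable_sums[OF summ[of j]] by (simp add: recurrent_def h_def)
qed

lemma vector_matrix_mat_power:
  assumes "q v* P = q"
  shows "q v* mat_power P k = q"
  by (induction k)
    (simp_all add: mat_power_def assms flip: vector_matrix_mul_assoc)

lemma mat_power_nonneg:
  assumes "stochastic_matrix P"
  shows "0 \<le> mat_power P k $ i $ j"
  using assms
  by (induction k arbitrary: i j)
    (auto simp: mat_power_def mat_def matrix_matrix_mult_def stochastic_matrix_def intro!: sum_nonneg)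

text \<open>If \<open>mat_power P k $ i $ j\<close> is positive, then entry \<open>j\<close> of the
  invariance equation for this power is a vanishing sum of nonnegative terms, so the term of
  \<open>i\<close> vanishes as well.\<close>

lemma invariant_zero_accessible:
  fixes P :: "real^'s::finite^'s"
  assumes "stochastic_matrix P" and inv: "r v* P = r" and r: "\<And>i. 0 \<le> r $ i"
    and "r $ j = 0" and "accessible P i j"
  shows "r $ i = 0"
proof -
  obtain k where k: "0 < mat_power P k $ i $ j"
    using assms by (auto simp: accessible_def)
  have "(\<Sum>l\<in>UNIV. r $ l * mat_power P k $ l $ j) = 0"
    using vector_matrix_mat_power[OF inv, of k] \<open>r $ j = 0\<close>
    by (simp add: vector_matrix_mult_def vec_eq_iff)
  then have "r $ i * mat_power P k $ i $ j = 0"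
    by (subst (asm) sum_nonneg_eq_0_iff) (auto simp: r mat_power_nonneg assms)
  then show ?thesis using k by simp
qed

text \<open>Subtracting from \<open>q\<close> the largest multiple of \<open>p\<close> that leaves a
  nonnegative vector creates a zero entry, and irreducibility spreads this zero to every
  state.\<close>

lemma invariant_vector_unique:
  fixes P :: "real^'s::finite^'s"
  assumes st: "stochastic_matrix P" and uni: "ergodic_unichain P"
    and p: "\<And>i. 0 < p $ i" and inv: "p v* P = p" and q: "q v* P = q"
  shows "\<exists>c. q = c *\<^sub>R p"
proof -
  obtain C where "ergodic_class P C" and "\<And>i. i \<notin> C \<Longrightarrow> \<not> recurrent P i"
    using uni by (auto simp: ergodic_unichain_def)
  \<comment> \<open>All states are recurrent, so none lies outside \<open>C\<close>.\<close>
  then have "communicating_class P UNIV"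
    using stationary_recurrent[OF st p inv] by (metis ergodic_class_def UNIV_eq_I)
  then obtain x where x: "accessible P x i" "accessible P i x" for i
    by (fastforce simp: communicating_class_def quotient_def)
  define c where "c = Min (range (\<lambda>i. q $ i / p $ i))"
  define r where "r = q - c *\<^sub>R p"
  have "c \<in> range (\<lambda>i. q $ i / p $ i)"
    unfolding c_def by (rule Min_in) auto
  then obtain i0 where i0: "c = q $ i0 / p $ i0" by blast
  have "c \<le> q $ i / p $ i" for i
    unfolding c_def by simp
  then have "c * p $ i \<le> q $ i" for i
    using p[of i] pos_le_divide_eq by blast
  then have r: "0 \<le> r $ i" for i
    by (simp add: r_def)
  have "r $ i0 = 0"
    using p[of i0] by (simp add: r_def i0)
  moreover have "r v* P = r"
    by (simp add: r_def vector_matrix_mult_diff_distrib scaleR_vector_matrix_assoc inv q)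
  ultimately have "r $ i = 0" for i
    using invariant_zero_accessible[OF st _ r] x by metis
  then have "q = c *\<^sub>R p"
    by (simp add: r_def vec_eq_iff)
  then show ?thesis ..
qed

section \<open>Poisson equation and exponential tilting\<close>

text \<open>The Poisson equation: by the Fredholm alternative it is solvable because its right-hand
  side is orthogonal to the kernel of the adjoint of \<open>1 - P\<close>, which is spanned by \<open>p\<close>.\<close>

lemma poisson_equation:
  fixes P :: "real^'s::finite^'s"
  assumes st: "stochastic_matrix P" and uni: "ergodic_unichain P"
    and p: "\<And>i. 0 < p $ i" and inv: "p v* P = p" and v: "p \<bullet> v = 0"
  shows "\<exists>u. u - P *v u = v"
proof -
  define R where "R = range (\<lambda>u. u - P *v u)"
  have lin: "linear (\<lambda>u. u - P *v u)"
    by (intro linear_compose_sub linear_ident matrix_vector_mul_linear)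
  have sub: "subspace R"
    unfolding R_def by (rule linear_subspace_image[OF lin subspace_UNIV])
  obtain y z where y: "y \<in> R" and z: "\<And>w. w \<in> R \<Longrightarrow> orthogonal z w" and vyz: "v = y + z"
    using orthogonal_subspace_decomp_exists[of R v] span_eq_iff[of R] sub by metis
  have "(z - z v* P) \<bullet> u = 0" for u
    using z[of "u - P *v u"]
    by (simp add: R_def orthogonal_def inner_diff_left inner_diff_right dot_lmul_matrix)
  \<comment> \<open>The vector is orthogonal to every \<open>u\<close>, in particular to
    itself.\<close>
  from this[of "z - z v* P"] have "z v* P = z"
    by simp
  then obtain c where c: "z = c *\<^sub>R p"
    using invariant_vector_unique[OF st uni p inv] by blast
  \<comment> \<open>\<open>p\<close> is orthogonal to all of \<open>R\<close> and to
    \<open>v\<close>, hence to \<open>z\<close>; being a multiple of \<open>p\<close>,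
    \<open>z\<close> is then orthogonal to itself and vanishes.\<close>
  have "p \<bullet> y = 0"
    using y by (auto simp: R_def inner_diff_right inv simp flip: dot_lmul_matrix)
  then have "p \<bullet> z = 0" using v vyz by (simp add: inner_add_right)
  then have "z \<bullet> z = 0" unfolding c by simp
  then show ?thesis using y vyz by (auto simp: R_def)
qed

text \<open>The weights are \<open>exp (\<theta> * u $ i)\<close> for a Poisson solution
  \<open>u\<close>. The corrected cost \<open>g i j + u $ j - u $ i\<close> has the same one-step
  mean \<rho> < 0 from every state \<open>i\<close>. Its moment generating function
  \<open>F i\<close> has value \<open>1\<close> and derivative \<rho> at \<open>0\<close>, so it
  drops below \<open>1\<close> just to the right of \<open>0\<close>.\<close>

lemma tilted_weights_exist:
  fixes P :: "real^'s::finite^'s" and g :: "'s \<Rightarrow> 's \<Rightarrow> real"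
  assumes st: "stochastic_matrix P" and uni: "ergodic_unichain P"
    and p: "\<And>i. 0 < p $ i" and inv: "p v* P = p" and p1: "(\<Sum>i\<in>UNIV. p $ i) = 1"
    and neg: "(\<Sum>i\<in>UNIV. p $ i * (\<Sum>j\<in>UNIV. P $ i $ j * g i j)) < 0"
  obtains \<theta> r :: real and w :: "'s \<Rightarrow> real" where "0 < \<theta>" and "0 \<le> r" and "r < 1" and "\<And>i. 0 < w i"
    and "\<And>i. (\<Sum>j\<in>UNIV. P $ i $ j * (exp (\<theta> * g i j) * w j)) \<le> r * w i"
proof -
  have row: "(\<Sum>l\<in>UNIV. P $ i $ l) = 1" and nn: "0 \<le> P $ i $ l" for i l
    using st by (auto simp: stochastic_matrix_def)
  define \<rho> where "\<rho> = (\<Sum>i\<in>UNIV. p $ i * (\<Sum>j\<in>UNIV. P $ i $ j * g i j))"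
  define v :: "real^'s" where "v = (\<chi> i. (\<Sum>j\<in>UNIV. P $ i $ j * g i j) - \<rho>)"
  have "p \<bullet> v = 0"
    by (simp add: inner_vec_def v_def right_diff_distrib sum_subtractf p1 \<rho>_def flip: sum_distrib_right)
  from poisson_equation[OF st uni p inv this] obtain u where u: "u - P *v u = v" ..
  define F where "F i \<theta> = (\<Sum>j\<in>UNIV. P $ i $ j * exp (\<theta> * (g i j + u $ j - u $ i)))" for i \<theta>
  have "\<exists>d>0. \<forall>\<theta>>0. \<theta> < d \<longrightarrow> F i \<theta> < 1" for i
  proof -
    have "(F i has_real_derivative (\<Sum>j\<in>UNIV. P $ i $ j * (g i j + u $ j - u $ i))) (at 0)"
      unfolding F_def by (auto intro!: derivative_eq_intros simp: ac_simps)
    also have "(\<Sum>j\<in>UNIV. P $ i $ j * (g i j + u $ j - u $ i))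
       = (\<Sum>j\<in>UNIV. P $ i $ j * g i j) + (P *v u) $ i - u $ i"
      by (simp add: distrib_left right_diff_distrib sum.distrib sum_subtractf matrix_vector_mult_def row
          flip: sum_distrib_right)
    also have "\<dots> = \<rho>"
      using arg_cong[OF u, of "\<lambda>x. x $ i"] by (simp add: v_def)
    finally have "(F i has_real_derivative \<rho>) (at 0)" .
    moreover have "\<rho> < 0" and "F i 0 = 1"
      using neg by (simp_all add: \<rho>_def F_def row)
    ultimately show ?thesis
      using DERIV_neg_dec_right[of "F i" \<rho> 0] by simp
  qed
  then obtain d where d: "\<And>i. 0 < d i" "\<And>i \<theta>. 0 < \<theta> \<Longrightarrow> \<theta> < d i \<Longrightarrow> F i \<theta> < 1"
    by metis
  \<comment> \<open>Finitely many states admit one common \<theta>; halving the minimum puts it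
    strictly below every \<open>d i\<close>.\<close>
  define \<theta> where "\<theta> = Min (range d) / 2"
  have m: "0 < Min (range d)" "Min (range d) \<le> d i" for i
    by (simp_all add: d)
  have \<theta>: "0 < \<theta>" "\<theta> < d i" for i
    unfolding \<theta>_def using m(1) m(2)[of i] by linarith+
  define r where "r = Max (range (\<lambda>i. F i \<theta>))"
  have r: "F i \<theta> \<le> r" for i unfolding r_def by simp
  show ?thesis
  proof (rule that[of \<theta> r "\<lambda>i. exp (\<theta> * u $ i)"])
    show "0 < \<theta>" by (rule \<theta>)
    show "r < 1" unfolding r_def using d(2)[OF \<theta>] by simp
    have "0 \<le> F i \<theta>" for i unfolding F_def by (intro sum_nonneg) (simp add: nn)
    then show "0 \<le> r" using r order_trans by blast
    show "(\<Sum>j\<in>UNIV. P $ i $ j * (exp (\<theta> * g i j) * exp (\<theta> * u $ j))) \<le> r * exp (\<theta> * u $ i)" for i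
    proof -
      have "(\<Sum>j\<in>UNIV. P $ i $ j * (exp (\<theta> * g i j) * exp (\<theta> * u $ j))) = F i \<theta> * exp (\<theta> * u $ i)"
        unfolding F_def sum_distrib_right
        by (intro sum.cong refl) (simp add: mult.assoc algebra_simps flip: exp_add)
      also have "\<dots> \<le> r * exp (\<theta> * u $ i)" using r by simp
      finally show ?thesis .
    qed
  qed simp
qed

section \<open>Almost sure decay along the process\<close>

text \<open>This is the tower property: given the history up to time \<open>k\<close>, the next
  state may be averaged over the current row of \<open>P\<close>. There are finitely many histories,
  so both integrals split into finite sums over cylinder events, to each of which the Markov
  property applies.\<close>

lemma dtmc_process_one_step:
  fixes \<phi> :: "(nat \<Rightarrow> 's::finite) \<Rightarrow> ennreal" and \<psi> :: "'s \<Rightarrow> 's \<Rightarrow> ennreal"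
  assumes X: "dtmc_process M X s0 P" and st: "stochastic_matrix P"
  defines "H \<equiv> \<lambda>k w. restrict (\<lambda>t. X t w) {..k}"
  shows "(\<integral>\<^sup>+ w. \<phi> (H k w) * \<psi> (X k w) (X (Suc k) w) \<partial>M)
       = (\<integral>\<^sup>+ w. \<phi> (H k w) * (\<Sum>j\<in>UNIV. ennreal (P $ X k w $ j) * \<psi> (X k w) j) \<partial>M)"
proof -
  interpret prob_space M using X by (simp add: dtmc_process_def)
  have [measurable]: "X k \<in> M \<rightarrow>\<^sub>M count_space UNIV" for k
    using X by (simp add: dtmc_process_def)
  \<comment> \<open>Restricted histories are extensional, so this set is finite and each sample
    point matches exactly one of its elements.\<close>
  define \<H> where "\<H> = PiE {..k} (\<lambda>_. UNIV :: 's set)"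
  have fin: "finite \<H>" by (simp add: \<H>_def finite_PiE)
  define C where "C h = {w \<in> space M. \<forall>t\<le>k. X t w = h t}" for h
  define D where "D h j = {w \<in> space M. (\<forall>t\<le>k. X t w = h t) \<and> X (Suc k) w = j}" for h j
  have [measurable]: "C h \<in> sets M" "D h j \<in> sets M" for h j
    unfolding C_def D_def by measurable
  have nn: "0 \<le> P $ i $ j" for i j
    using st by (simp add: stochastic_matrix_def)
  have D_eq: "emeasure M (D h j) = emeasure M (C h) * ennreal (P $ h k $ j)" for h j
    using X by (simp add: emeasure_eq_measure C_def D_def dtmc_process_def nn flip: ennreal_mult')
  have H_in: "H k w \<in> \<H>" for w by (auto simp: H_def \<H>_def)
  have C_iff: "w \<in> C h \<longleftrightarrow> h = H k w" if "w \<in> space M" "h \<in> \<H>" for w h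
    using that by (auto simp: C_def H_def \<H>_def PiE_def extensional_def fun_eq_iff)
  have D_iff: "w \<in> D h j \<longleftrightarrow> h = H k w \<and> j = X (Suc k) w" if "w \<in> space M" "h \<in> \<H>" for w h j
    using C_iff[OF that] by (auto simp: C_def D_def)
  have Hk: "H k w k = X k w" for w by (simp add: H_def)
  have "(\<integral>\<^sup>+ w. \<phi> (H k w) * \<psi> (X k w) (X (Suc k) w) \<partial>M)
      = (\<integral>\<^sup>+ w. (\<Sum>h\<in>\<H>. \<Sum>j\<in>UNIV. \<phi> h * \<psi> (h k) j * indicator (D h j) w) \<partial>M)"
  proof (rule nn_integral_cong)
    fix w assume w: "w \<in> space M"
    have "(\<Sum>h\<in>\<H>. \<Sum>j\<in>UNIV. \<phi> h * \<psi> (h k) j * indicator (D h j) w)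
       = (\<Sum>h\<in>\<H>. if h = H k w then
             \<Sum>j\<in>UNIV. if j = X (Suc k) w then \<phi> h * \<psi> (h k) j else 0 else 0)"
      by (intro sum.cong refl) (auto simp: indicator_def D_iff[OF w] intro!: sum.cong)
    also have "\<dots> = \<phi> (H k w) * \<psi> (X k w) (X (Suc k) w)"
      using fin H_in by (simp add: Hk)
    finally show "\<phi> (H k w) * \<psi> (X k w) (X (Suc k) w)
      = (\<Sum>h\<in>\<H>. \<Sum>j\<in>UNIV. \<phi> h * \<psi> (h k) j * indicator (D h j) w)" by simp
  qed
  also have "\<dots> = (\<Sum>h\<in>\<H>. \<Sum>j\<in>UNIV. \<phi> h * \<psi> (h k) j * (emeasure M (C h) * ennreal (P $ h k $ j)))"
    by (simp add: nn_integral_sum nn_integral_cmult_indicator D_eq del: sum_mult_indicator)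
  also have "\<dots> = (\<Sum>h\<in>\<H>. (\<phi> h * (\<Sum>j\<in>UNIV. ennreal (P $ h k $ j) * \<psi> (h k) j)) * emeasure M (C h))"
    by (simp add: sum_distrib_left sum_distrib_right mult_ac)
  also have "\<dots> = (\<integral>\<^sup>+ w. (\<Sum>h\<in>\<H>. (\<phi> h * (\<Sum>j\<in>UNIV. ennreal (P $ h k $ j) * \<psi> (h k) j))
      * indicator (C h) w) \<partial>M)"
    by (simp add: nn_integral_sum nn_integral_cmult_indicator del: sum_mult_indicator)
  also have "\<dots> = (\<integral>\<^sup>+ w. \<phi> (H k w) * (\<Sum>j\<in>UNIV. ennreal (P $ X k w $ j) * \<psi> (X k w) j) \<partial>M)"
  proof (rule nn_integral_cong)
    fix w assume w: "w \<in> space M"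
    have "(\<Sum>h\<in>\<H>. (\<phi> h * (\<Sum>j\<in>UNIV. ennreal (P $ h k $ j) * \<psi> (h k) j)) * indicator (C h) w)
      = (\<Sum>h\<in>\<H>. if h = H k w then \<phi> h * (\<Sum>j\<in>UNIV. ennreal (P $ h k $ j) * \<psi> (h k) j) else 0)"
      by (intro sum.cong refl) (auto simp: indicator_def C_iff[OF w])
    then show "(\<Sum>h\<in>\<H>. (\<phi> h * (\<Sum>j\<in>UNIV. ennreal (P $ h k $ j) * \<psi> (h k) j)) * indicator (C h) w)
      = \<phi> (H k w) * (\<Sum>j\<in>UNIV. ennreal (P $ X k w $ j) * \<psi> (X k w) j)"
      using fin H_in by (simp add: Hk)
  qed
  finally show ?thesis .
qed

text \<open>The series of the \<open>Z k\<close> has finite expectation, so it converges almost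
  surely and its terms tend to \<open>0\<close>.\<close>

lemma AE_tendsto_0_of_geometric_bound:
  fixes Z :: "nat \<Rightarrow> 'w \<Rightarrow> real"
  assumes [measurable]: "\<And>k. Z k \<in> borel_measurable M"
    and nonneg: "\<And>k w. 0 \<le> Z k w" and "0 \<le> r" "r < 1" "0 \<le> K"
    and bound: "\<And>k. (\<integral>\<^sup>+ w. ennreal (Z k w) \<partial>M) \<le> ennreal (K * r ^ k)"
  shows "AE w in M. (\<lambda>k. Z k w) \<longlonglongrightarrow> 0"
proof -
  have "(\<integral>\<^sup>+ w. (\<Sum>k. ennreal (Z k w)) \<partial>M) = (\<Sum>k. \<integral>\<^sup>+ w. ennreal (Z k w) \<partial>M)"
    by (rule nn_integral_suminf) simp
  also have "\<dots> \<le> (\<Sum>k. ennreal (K * r ^ k))"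
    by (intro suminf_le bound) auto
  also have "\<dots> = ennreal (\<Sum>k. K * r ^ k)"
    using assms by (intro suminf_ennreal2) (auto intro!: summable_mult summable_geometric)
  also have "\<dots> < \<infinity>" by simp
  finally have "AE w in M. (\<Sum>k. ennreal (Z k w)) \<noteq> \<infinity>"
    by (intro nn_integral_PInf_AE) auto
  then show ?thesis
  proof eventually_elim
    case (elim w)
    then have "summable (\<lambda>k. Z k w)"
      by (intro summable_suminf_not_top) (auto simp: nonneg)
    then show ?case by (rule summable_LIMSEQ_zero)
  qed
qed

text \<open>By \<open>super\<close>, the expectation of the product times \<open>w (X k x)\<close>
  shrinks at least by the factor \<open>r\<close> in each step. A positive lower bound of
  \<open>w\<close> removes the weight at the end.\<close>

lemma dtmc_process_product_tendsto_0:
  fixes P :: "real^'s::finite^'s" and e :: "'s \<Rightarrow> 's \<Rightarrow> real" and w :: "'s \<Rightarrow> real"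
  assumes X: "dtmc_process M X s0 P" and st: "stochastic_matrix P"
    and e: "\<And>i j. 0 \<le> e i j" and w: "\<And>i. 0 < w i" and r: "0 \<le> r" "r < 1"
    and super: "\<And>i. (\<Sum>j\<in>UNIV. P $ i $ j * (e i j * w j)) \<le> r * w i"
  shows "AE x in M. (\<lambda>k. \<Prod>t<k. e (X t x) (X (Suc t) x)) \<longlonglongrightarrow> 0"
proof -
  interpret prob_space M using X by (simp add: dtmc_process_def)
  have [measurable]: "X k \<in> M \<rightarrow>\<^sub>M count_space UNIV" for k
    using X by (simp add: dtmc_process_def)
  have nn: "0 \<le> P $ i $ j" for i j
    using st by (simp add: stochastic_matrix_def)
  define Z where "Z k x = (\<Prod>t<k. e (X t x) (X (Suc t) x))" for k x
  have Z0: "0 \<le> Z k x" for k x by (auto simp: Z_def intro!: prod_nonneg e)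
  have [measurable]: "(\<lambda>x. f (X k x) (X l x)) \<in> borel_measurable M" for f :: "'s \<Rightarrow> 's \<Rightarrow> real" and k l
    by (rule measurable_compose_countable[of "\<lambda>i x. f i (X l x)"]) auto
  have [measurable]: "(\<lambda>x. w (X k x)) \<in> borel_measurable M" for k
    by (rule measurable_compose[of "X k" M "count_space UNIV"]) auto
  have [measurable]: "Z k \<in> borel_measurable M" for k
    unfolding Z_def by measurable
  define K where "K = Max (range w)"
  have wK: "w i \<le> K" for i by (simp add: K_def)
  then have K0: "0 \<le> K" using w less_le_trans less_imp_le by metis
  have "(\<integral>\<^sup>+ x. ennreal (Z k x * w (X k x)) \<partial>M) \<le> ennreal (K * r ^ k)" for k
  proof (induction k)
    case 0
    have "(\<integral>\<^sup>+ x. ennreal (w (X 0 x)) \<partial>M) \<le> (\<integral>\<^sup>+ x. ennreal K \<partial>M)"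
      by (intro nn_integral_mono ennreal_leI wK)
    then show ?case by (simp add: Z_def emeasure_space_1)
  next
    case (Suc k)
    \<comment> \<open>The factors with \<open>t < k\<close> involve only states at times up to
      \<open>k\<close>. The product is thus a function of the history, and only the state at time
      \<open>Suc k\<close> is averaged.\<close>
    define \<phi> where "\<phi> h = ennreal (\<Prod>t<k. e (h t) (h (Suc t)))" for h
    have \<phi>: "\<phi> (restrict (\<lambda>t. X t x) {..k}) = ennreal (Z k x)" for x
      by (auto simp: \<phi>_def Z_def intro!: arg_cong[of _ _ ennreal] prod.cong)
    have "(\<integral>\<^sup>+ x. ennreal (Z (Suc k) x * w (X (Suc k) x)) \<partial>M)
       = (\<integral>\<^sup>+ x. ennreal (Z k x) * ennreal (e (X k x) (X (Suc k) x) * w (X (Suc k) x)) \<partial>M)"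
      by (intro nn_integral_cong, subst ennreal_mult[symmetric])
        (auto simp: Z0 e w less_imp_le, simp add: Z_def mult.assoc)
    also have "\<dots> = (\<integral>\<^sup>+ x. ennreal (Z k x) *
        (\<Sum>j\<in>UNIV. ennreal (P $ X k x $ j) * ennreal (e (X k x) j * w j)) \<partial>M)"
      using dtmc_process_one_step[OF X st, of \<phi> k "\<lambda>i j. ennreal (e i j * w j)"]
      by (simp add: \<phi>)
    also have "\<dots> \<le> (\<integral>\<^sup>+ x. ennreal r * ennreal (Z k x * w (X k x)) \<partial>M)"
    proof (rule nn_integral_mono)
      fix x
      have "(\<Sum>j\<in>UNIV. ennreal (P $ X k x $ j) * ennreal (e (X k x) j * w j))
        = ennreal (\<Sum>j\<in>UNIV. P $ X k x $ j * (e (X k x) j * w j))"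
        by (subst sum_ennreal[symmetric]) (auto simp: nn e w less_imp_le ennreal_mult)
      also have "\<dots> \<le> ennreal (r * w (X k x))" by (intro ennreal_leI super)
      finally have "ennreal (Z k x) * (\<Sum>j\<in>UNIV. ennreal (P $ X k x $ j) * ennreal (e (X k x) j * w j))
        \<le> ennreal (Z k x) * ennreal (r * w (X k x))" by (rule mult_left_mono) simp
      also have "\<dots> = ennreal r * ennreal (Z k x * w (X k x))"
        using r by (simp add: Z0 w less_imp_le ac_simps flip: ennreal_mult)
      finally show "ennreal (Z k x) * (\<Sum>j\<in>UNIV. ennreal (P $ X k x $ j) * ennreal (e (X k x) j * w j))
        \<le> ennreal r * ennreal (Z k x * w (X k x))" .
    qed
    also have "\<dots> = ennreal r * (\<integral>\<^sup>+ x. ennreal (Z k x * w (X k x)) \<partial>M)"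
      by (rule nn_integral_cmult) simp
    also have "\<dots> \<le> ennreal r * ennreal (K * r ^ k)"
      by (rule mult_left_mono[OF Suc]) simp
    also have "\<dots> = ennreal (K * r ^ Suc k)"
      using r K0 by (simp add: ac_simps flip: ennreal_mult)
    finally show ?case .
  qed
  then have "AE x in M. (\<lambda>k. Z k x * w (X k x)) \<longlonglongrightarrow> 0"
    using r K0 by (intro AE_tendsto_0_of_geometric_bound[of _ M r K]) (auto simp: Z0 w less_imp_le)
  then show ?thesis
  proof eventually_elim
    case (elim x)
    define m where "m = Min (range w)"
    have m: "0 < m" "m \<le> w i" for i by (simp_all add: m_def w)
    have lim: "(\<lambda>k. Z k x * w (X k x) / m) \<longlonglongrightarrow> 0"
      using tendsto_divide_zero[OF elim] .
    have "norm (Z k x) \<le> Z k x * w (X k x) / m" for k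
      using m mult_left_mono[OF m(2) Z0] by (simp add: Z0 pos_le_divide_eq)
    then have "(\<lambda>k. Z k x) \<longlonglongrightarrow> 0"
      by (intro Lim_null_comparison[OF _ lim] always_eventually allI)
    then show ?case by (simp add: Z_def)
  qed
qed

section \<open>Lyapunov functions along trajectories\<close>

text \<open>Radial unboundedness keeps \<open>V s\<close> at least \<open>1\<close> outside a ball
  of radius \<open>b\<close>. On the compact shell \<open>S\<close> between the radii \<delta> and
  \<open>b\<close>, continuity gives a positive minimum; the smaller of the two bounds serves as
  \<eta>. If the shell is empty, \<open>1\<close> suffices.\<close>

lemma lyapunov_small_imp_small:
  assumes V: "lyapunov_candidate V" and "0 < \<delta>"
  shows "\<exists>\<eta>>0. \<forall>x. V s x < \<eta> \<longrightarrow> norm (x :: real^'n) < \<delta>"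
proof -
  have cont: "continuous_on UNIV (V s)" and rad: "filterlim (V s) at_top at_infinity"
    and pos: "\<And>x. x \<noteq> 0 \<Longrightarrow> 0 < V s x"
    using V by (auto simp: lyapunov_candidate_def)
  have "eventually (\<lambda>x. 1 \<le> V s x) at_infinity"
    using rad by (simp add: filterlim_at_top)
  then obtain b where b: "\<And>x. b \<le> norm x \<Longrightarrow> 1 \<le> V s x"
    by (auto simp: eventually_at_infinity)
  define S where "S = cball 0 b - ball (0 :: real^'n) \<delta>"
  have "compact S" unfolding S_def by (intro compact_diff) auto
  show ?thesis
  proof (cases "S = {}")
    case True
    have "norm x < \<delta>" if "V s x < 1" for x
    proof (rule ccontr)
      assume "\<not> norm x < \<delta>"
      then have "x \<in> S" using b[of x] that by (cases "norm x \<le> b") (auto simp: S_def)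
      then show False using True by simp
    qed
    then show ?thesis by (intro exI[of _ 1]) auto
  next
    case False
    obtain y where y: "y \<in> S" "\<And>x. x \<in> S \<Longrightarrow> V s y \<le> V s x"
      using continuous_attains_inf[OF \<open>compact S\<close> False continuous_on_subset[OF cont]] by auto
    have "y \<noteq> 0" using y(1) \<open>0 < \<delta>\<close> by (auto simp: S_def)
    have "norm x < \<delta>" if "V s x < min 1 (V s y)" for x
    proof (rule ccontr)
      assume "\<not> norm x < \<delta>"
      then have "x \<in> S" using b[of x] that by (cases "norm x \<le> b") (auto simp: S_def)
      then show False using y(2) that by fastforce
    qed
    then show ?thesis using pos[OF \<open>y \<noteq> 0\<close>] by (intro exI[of _ "min 1 (V s y)"]) auto
  qed
qed

text \<open>The mode may change forever, so one threshold must serve all modes: the minimum of the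
  individual ones over the finite mode set.\<close>

lemma lyapunov_tendsto_0:
  fixes V :: "'s::finite \<Rightarrow> real^'n \<Rightarrow> real"
  assumes V: "lyapunov_candidate V" and lim: "(\<lambda>k. V (m k) (x k)) \<longlonglongrightarrow> 0"
  shows "x \<longlonglongrightarrow> 0"
proof (rule tendstoI)
  fix \<delta> :: real assume "0 < \<delta>"
  then obtain \<eta> where \<eta>: "\<And>s. 0 < \<eta> s" "\<And>s y. V s y < \<eta> s \<Longrightarrow> norm y < \<delta>"
    using lyapunov_small_imp_small[OF V] by metis
  have "eventually (\<lambda>k. V (m k) (x k) < Min (range \<eta>)) sequentially"
    using lim by (rule order_tendstoD) (simp add: \<eta>)
  then show "eventually (\<lambda>k. dist (x k) 0 < \<delta>) sequentially"
  proof eventually_elim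
    case (elim k)
    then have "V (m k) (x k) < \<eta> (m k)" by simp
    then show ?case using \<eta>(2) by simp
  qed
qed

text \<open>Each step first contracts the function of the current mode and then compares it with the
  function of the next mode.\<close>

lemma lyapunov_jls_state_le:
  fixes V :: "'s::finite \<Rightarrow> real^'n \<Rightarrow> real"
  assumes \<alpha>: "\<And>s. \<alpha> s < 1" and \<mu>: "\<And>s. 1 < \<mu> s"
    and decr: "\<And>s x. V s (A s *v x) - V s x \<le> - \<alpha> s * V s x"
    and jump: "\<And>s s' x. V s x \<le> \<mu> s * V s' x"
  shows "V (m k) (jls_state A m x0 k)
     \<le> (\<Prod>t<k. (1 - \<alpha> (m t)) * (if m (Suc t) = m t then 1 else \<mu> (m (Suc t)))) * V (m 0) x0"
proof (induction k)
  case 0 then show ?case by simp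
next
  case (Suc k)
  \<comment> \<open>Staying in a mode costs no factor, which matches the restriction to
    \<open>j \<noteq> i\<close> in the linear inequality.\<close>
  define b where "b = (if m (Suc k) = m k then 1 else \<mu> (m (Suc k)))"
  have "0 < b" using \<mu>[of "m (Suc k)"] by (simp add: b_def)
  let ?x = "jls_state A m x0 k"
  have "V (m (Suc k)) (jls_state A m x0 (Suc k)) \<le> b * V (m k) (A (m k) *v ?x)"
    using jump by (simp add: b_def)
  also have "\<dots> \<le> b * ((1 - \<alpha> (m k)) * V (m k) ?x)"
    using decr[of "m k" ?x] \<open>0 < b\<close> by (intro mult_left_mono) (auto simp: algebra_simps)
  also have "\<dots> \<le> b * ((1 - \<alpha> (m k)) * ((\<Prod>t<k. (1 - \<alpha> (m t)) *
      (if m (Suc t) = m t then 1 else \<mu> (m (Suc t)))) * V (m 0) x0))"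
    using Suc \<alpha>[of "m k"] \<open>0 < b\<close> by (intro mult_left_mono) auto
  finally show ?case by (simp add: b_def mult_ac)
qed

section \<open>Diagonal scaling and feasibility\<close>

lemma diag_mult: "(diag v ** B) $ i $ j = v $ i * B $ i $ j"
proof -
  have "(diag v ** B) $ i $ j = (\<Sum>k\<in>UNIV. if k = i then v $ i * B $ i $ j else 0)"
    unfolding matrix_matrix_mult_def diag_def vec_lambda_beta by (intro sum.cong) auto
  then show ?thesis by simp
qed

lemma matrix_inv_diag_mult:
  fixes v :: "real^'s::finite" and B :: "real^'m^'s"
  assumes v: "\<And>i. v $ i \<noteq> 0"
  shows "matrix_inv (diag v) ** B = (\<chi> i j. B $ i $ j / v $ i)"
proof -
  define D where "D = diag (\<chi> i. 1 / v $ i)"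
  have inv: "diag v ** D = mat 1" "D ** diag v = mat 1"
    unfolding D_def vec_eq_iff diag_mult by (simp_all add: diag_def mat_def v)
  \<comment> \<open>\<open>matrix_inv\<close> chooses some two-sided inverse. The witness
    \<open>D\<close> shows that one exists, and cancellation then identifies the choice with
    \<open>D\<close>.\<close>
  then have "diag v ** matrix_inv (diag v) = mat 1"
    unfolding matrix_inv_def by (rule someI2[of _ D, OF conjI]) blast
  then have eq: "matrix_inv (diag v) = D"
    using inv(2) by (metis matrix_mul_assoc matrix_mul_lid matrix_mul_rid)
  show ?thesis
    unfolding eq D_def vec_eq_iff by (simp add: diag_mult)
qed

text \<open>The LP does not exclude unavailable actions explicitly, but mass placed on them would be lost
  in \<open>Ph\<close>, whose total mass is that of \<open>p\<close>.\<close>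

lemma lp_feasible_unavailable:
  assumes mdp: "mdp T" and feas: "lp_feasible T \<alpha> \<mu> \<epsilon> \<pi>h p Ph"
    and un: "\<not> available T s \<sigma>"
  shows "\<pi>h $ s $ \<sigma> = 0"
proof -
  have rows: "(\<Sum>\<sigma>\<in>UNIV. \<pi>h $ i $ \<sigma>) = p $ i" and cols: "(\<Sum>j\<in>UNIV. Ph $ j $ i) = p $ i"
    and Ph: "Ph $ i $ j = (\<Sum>\<sigma>\<in>UNIV. T i \<sigma> j * \<pi>h $ i $ \<sigma>)"
    and nonneg: "0 \<le> \<pi>h $ i $ \<tau>" for i j \<tau>
    using feas by (auto simp: lp_feasible_def matrix_vector_mult_def transpose_def vec_eq_iff
        vector_matrix_mult_def)
  have le: "(\<Sum>j\<in>UNIV. T i \<tau> j) \<le> 1" for i \<tau>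
    using mdp by (cases "available T i \<tau>") (auto simp: mdp_def available_def)
  have "(\<Sum>i\<in>UNIV. \<Sum>\<tau>\<in>UNIV. (1 - (\<Sum>j\<in>UNIV. T i \<tau> j)) * \<pi>h $ i $ \<tau>)
      = (\<Sum>i\<in>UNIV. p $ i) - (\<Sum>i\<in>UNIV. \<Sum>\<tau>\<in>UNIV. \<Sum>j\<in>UNIV. T i \<tau> j * \<pi>h $ i $ \<tau>)"
    by (simp add: left_diff_distrib sum_subtractf rows sum_distrib_right)
  also have "(\<Sum>i\<in>UNIV. \<Sum>\<tau>\<in>UNIV. \<Sum>j\<in>UNIV. T i \<tau> j * \<pi>h $ i $ \<tau>) = (\<Sum>i\<in>UNIV. \<Sum>j\<in>UNIV. Ph $ i $ j)"
    unfolding Ph by (intro sum.cong refl sum.swap)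
  also have "\<dots> = (\<Sum>j\<in>UNIV. p $ j)"
    by (subst sum.swap) (simp add: cols)
  finally have "(\<Sum>i\<in>UNIV. \<Sum>\<tau>\<in>UNIV. (1 - (\<Sum>j\<in>UNIV. T i \<tau> j)) * \<pi>h $ i $ \<tau>) = 0"
    by simp
  then have "(\<Sum>\<tau>\<in>UNIV. (1 - (\<Sum>j\<in>UNIV. T s \<tau> j)) * \<pi>h $ s $ \<tau>) = 0"
    by (subst (asm) sum_nonneg_eq_0_iff) (auto intro!: sum_nonneg mult_nonneg_nonneg simp: le nonneg)
  then have "(1 - (\<Sum>j\<in>UNIV. T s \<sigma> j)) * \<pi>h $ s $ \<sigma> = 0"
    by (subst (asm) sum_nonneg_eq_0_iff) (auto intro!: mult_nonneg_nonneg simp: le nonneg)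
  then show ?thesis
    using un by (simp add: available_def)
qed

section \<open>From the linear inequality to stability\<close>

lemma stable_wp1_of_negative_drift:
  fixes P :: "real^'s::finite^'s" and A :: "'s \<Rightarrow> real^'n^'n"
  assumes sc: "stability_constants A \<alpha> \<mu>"
    and st: "stochastic_matrix P" and uni: "ergodic_unichain P"
    and p: "\<And>i. 0 < p $ i" and inv: "p v* P = p" and p1: "(\<Sum>i\<in>UNIV. p $ i) = 1"
    and neg: "(\<Sum>i\<in>UNIV. (\<Sum>j\<in>UNIV - {i}. p $ j * P $ j $ i) * ln (\<mu> i) + p $ i * ln (1 - \<alpha> i)) < 0"
    and X: "dtmc_process M X s0 P"
  shows "stable_wp1 M X A"
  unfolding stable_wp1_def
proof
  fix x0 :: "real^'n"
  obtain V where V: "lyapunov_candidate V"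
    and decr: "\<And>s x. V s (A s *v x) - V s x \<le> - \<alpha> s * V s x"
    and jump: "\<And>s s' x. V s x \<le> \<mu> s * V s' x"
    using sc by (auto simp: stability_constants_def)
  have \<alpha>: "\<alpha> s < 1" and \<mu>: "1 < \<mu> s" for s
    using sc by (auto simp: stability_constants_def)
  \<comment> \<open>The factor by which the Lyapunov bound is multiplied in a transition from
    \<open>i\<close> to \<open>j\<close>; its logarithm is the cost \<open>g\<close>.\<close>
  define a where "a i j = (1 - \<alpha> i) * (if j = i then 1 else \<mu> j)" for i j
  have a: "0 < a i j" for i j
    using \<alpha>[of i] \<mu>[of j] by (simp add: a_def)
  have ln_a: "ln (a i j) = ln (1 - \<alpha> i) + (if j = i then 0 else ln (\<mu> j))" for i j
    using \<alpha>[of i] \<mu>[of j] by (simp add: a_def ln_mult)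
  have row: "(\<Sum>j\<in>UNIV. P $ i $ j) = 1" for i
    using st by (simp add: stochastic_matrix_def)
  have "(\<Sum>i\<in>UNIV. p $ i * (\<Sum>j\<in>UNIV. P $ i $ j * ln (a i j)))
     = (\<Sum>i\<in>UNIV. p $ i * ln (1 - \<alpha> i))
      + (\<Sum>i\<in>UNIV. \<Sum>j\<in>UNIV. p $ i * P $ i $ j * (if j = i then 0 else ln (\<mu> j)))"
    by (simp add: ln_a distrib_left sum.distrib sum_distrib_left row mult.assoc flip: sum_distrib_right)
  \<comment> \<open>The switching costs are regrouped by the mode entered, as in \<open>neg\<close>;
    the diagonal terms are zero.\<close>
  also have "(\<Sum>i\<in>UNIV. \<Sum>j\<in>UNIV. p $ i * P $ i $ j * (if j = i then 0 else ln (\<mu> j)))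
      = (\<Sum>j\<in>UNIV. \<Sum>i\<in>UNIV - {j}. p $ i * P $ i $ j * ln (\<mu> j))"
    by (subst sum.swap, rule sum.cong[OF refl], rule sum.mono_neutral_cong_right) auto
  also have "(\<Sum>i\<in>UNIV. p $ i * ln (1 - \<alpha> i)) + \<dots> < 0"
    using neg by (simp add: sum.distrib sum_distrib_right add.commute)
  finally obtain \<theta> r w where \<theta>: "0 < \<theta>" and r: "0 \<le> r" "r < 1" and w: "\<And>i. 0 < w i"
    and super: "\<And>i. (\<Sum>j\<in>UNIV. P $ i $ j * (exp (\<theta> * ln (a i j)) * w j)) \<le> r * w i"
    by (rule tilted_weights_exist[OF st uni p inv p1]) blast
  have "AE x in M. (\<lambda>k. \<Prod>t<k. exp (\<theta> * ln (a (X t x) (X (Suc t) x)))) \<longlonglongrightarrow> 0"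
    by (rule dtmc_process_product_tendsto_0[OF X st _ w r super]) (rule exp_ge_zero)
  then show "AE x in M. (\<lambda>k. infnorm (jls_state A (\<lambda>k. X k x) x0 k)) \<longlonglongrightarrow> 0"
  proof eventually_elim
    case (elim x)
    let ?Q = "\<lambda>k. \<Prod>t<k. a (X t x) (X (Suc t) x)"
    let ?y = "jls_state A (\<lambda>k. X k x) x0"
    have "(\<Prod>t<k. exp (\<theta> * ln (a (X t x) (X (Suc t) x)))) = ?Q k powr \<theta>" for k
    proof -
      have "exp (\<theta> * ln (a i j)) = a i j powr \<theta>" for i j
        using a[of i j] by (simp add: powr_def)
      then show ?thesis by (simp add: prod_powr_distrib a less_imp_le)
    qed
    \<comment> \<open>The decay is known for the product to the power \<theta>; the power
      \<open>1 / \<theta>\<close> recovers the product itself.\<close>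
    with elim have "(\<lambda>k. (?Q k powr \<theta>) powr (1 / \<theta>)) \<longlonglongrightarrow> 0 powr (1 / \<theta>)"
      using \<theta> by (intro tendsto_powr') auto
    then have "?Q \<longlonglongrightarrow> 0"
      using \<theta> by (simp add: powr_powr prod_nonneg a less_imp_le)
    then have lim: "(\<lambda>k. ?Q k * V (X 0 x) x0) \<longlonglongrightarrow> 0"
      by (rule tendsto_mult_left_zero)
    have V0: "0 \<le> V s y" for s y
      using V by (cases "y = 0") (auto simp: lyapunov_candidate_def less_imp_le)
    have "norm (V (X k x) (?y k)) \<le> ?Q k * V (X 0 x) x0" for k
      using lyapunov_jls_state_le[where V = V and m = "\<lambda>k. X k x", OF \<alpha> \<mu> decr jump] V0
      by (simp add: a_def)
    then have "(\<lambda>k. V (X k x) (?y k)) \<longlonglongrightarrow> 0"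
      by (intro Lim_null_comparison[OF _ lim] always_eventually allI)
    then have "?y \<longlonglongrightarrow> 0"
      by (rule lyapunov_tendsto_0[OF V])
    then have lim': "(\<lambda>k. norm (?y k)) \<longlonglongrightarrow> 0"
      by (rule tendsto_norm_zero)
    show ?case
      by (intro Lim_null_comparison[OF _ lim'] always_eventually allI)
        (simp add: infnorm_pos_le infnorm_le_norm)
  qed
qed

theorem theorem7:
  fixes T :: "'s::finite \<Rightarrow> 'a::finite \<Rightarrow> 's \<Rightarrow> real"
    and s0 :: 's
    and A :: "'s \<Rightarrow> real^'n^'n"
    and \<alpha> \<mu> c :: "'s \<Rightarrow> real"
    and \<epsilon> :: real
    and \<pi>opt :: "real^'a^'s" and popt :: "real^'s" and Popt :: "real^'s^'s"
    and \<pi> :: "real^'a^'s" and P :: "real^'s^'s"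
  assumes "ergodic_unichain_mdp T"
    and "stability_constants A \<alpha> \<mu>"
    and "0 < \<epsilon>"
    and "lp_optimal T \<alpha> \<mu> \<epsilon> c \<pi>opt popt Popt"
    and "\<pi> = matrix_inv (diag popt) ** \<pi>opt"
    and "P = matrix_inv (diag popt) ** Popt"
  shows "policy T \<pi>
    \<and> stochastic_matrix P \<and> P = induced_matrix T \<pi>
    \<and> (\<forall>q. stationary_distribution P q \<longleftrightarrow> q = popt)
    \<and> (\<forall>(M :: 'w measure) X. dtmc_process M X s0 P \<longrightarrow> stable_wp1 M X A)"
proof -
  have mdp: "mdp T" using assms(1) by (simp add: ergodic_unichain_mdp_def)
  have feas: "lp_feasible T \<alpha> \<mu> \<epsilon> \<pi>opt popt Popt"
    using assms(4) by (simp add: lp_optimal_def)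
  have rows: "(\<Sum>\<sigma>\<in>UNIV. \<pi>opt $ i $ \<sigma>) = popt $ i" and cols: "(\<Sum>j\<in>UNIV. Popt $ j $ i) = popt $ i"
    and Popt: "Popt $ i $ j = (\<Sum>\<sigma>\<in>UNIV. T i \<sigma> j * \<pi>opt $ i $ \<sigma>)"
    and nonneg: "0 \<le> \<pi>opt $ i $ \<sigma>" and p1: "(\<Sum>i\<in>UNIV. popt $ i) = 1"
    and neg: "(\<Sum>i\<in>UNIV. (\<Sum>j\<in>UNIV - {i}. Popt $ j $ i) * ln (\<mu> i) + popt $ i * ln (1 - \<alpha> i)) < 0"
    for i j \<sigma>
    using feas by (auto simp: lp_feasible_def matrix_vector_mult_def transpose_def vec_eq_iff
        vector_matrix_mult_def inner_vec_def)
  have p: "0 < popt $ i" for i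
    using feas assms(3) by (auto simp: lp_feasible_def intro: less_le_trans)
  then have pnz: "popt $ i \<noteq> 0" for i by (metis less_irrefl)
  have \<pi>: "\<pi> $ i $ \<sigma> = \<pi>opt $ i $ \<sigma> / popt $ i" and P: "P $ i $ j = Popt $ i $ j / popt $ i" for i j \<sigma>
    by (simp_all add: assms matrix_inv_diag_mult[OF pnz])
  have T0: "0 \<le> T i \<sigma> j" for i \<sigma> j
    using mdp by (cases "available T i \<sigma>") (auto simp: mdp_def available_def)
  have pol: "policy T \<pi>"
  proof -
    have \<pi>0: "0 \<le> \<pi> $ i $ \<sigma>" for i \<sigma>
      using nonneg p by (simp add: \<pi> less_imp_le)
    have sum1: "(\<Sum>\<sigma>\<in>UNIV. \<pi> $ i $ \<sigma>) = 1" for i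
      by (simp add: \<pi> rows pnz flip: sum_divide_distrib)
    have "\<pi> $ i $ \<sigma> \<le> 1" for i \<sigma>
      using member_le_sum[of \<sigma> UNIV "\<lambda>\<sigma>. \<pi> $ i $ \<sigma>"] \<pi>0 by (simp add: sum1)
    then show ?thesis
      using \<pi>0 sum1 lp_feasible_unavailable[OF mdp feas] by (simp add: policy_def \<pi>)
  qed
  have P_eq: "P = induced_matrix T \<pi>"
    by (simp add: vec_eq_iff induced_matrix_def P \<pi> Popt sum_divide_distrib)
  have st: "stochastic_matrix P"
    unfolding stochastic_matrix_def
  proof (intro conjI allI)
    fix i j
    show "0 \<le> P $ i $ j"
      using pol T0 by (auto simp: P_eq induced_matrix_def policy_def intro!: sum_nonneg)
    have "(\<Sum>j\<in>UNIV. P $ i $ j) = (\<Sum>\<sigma>\<in>UNIV. (\<Sum>j\<in>UNIV. T i \<sigma> j) * \<pi> $ i $ \<sigma>)"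
      unfolding P_eq induced_matrix_def by (simp add: sum_distrib_right) (rule sum.swap)
    also have "\<dots> = (\<Sum>\<sigma>\<in>UNIV. \<pi> $ i $ \<sigma>)"
    proof (rule sum.cong[OF refl])
      fix \<sigma>
      show "(\<Sum>j\<in>UNIV. T i \<sigma> j) * \<pi> $ i $ \<sigma> = \<pi> $ i $ \<sigma>"
        using mdp pol by (cases "available T i \<sigma>") (auto simp: mdp_def policy_def)
    qed
    also have "\<dots> = 1" using pol by (simp add: policy_def)
    finally show "(\<Sum>j\<in>UNIV. P $ i $ j) = 1" .
  qed
  have uni: "ergodic_unichain P"
    using assms(1) pol by (simp add: P_eq ergodic_unichain_mdp_def)
  \<comment> \<open>\<open>Popt\<close> records the flow of \<open>popt\<close> along each
    transition, so the constraint on its column sums is exactly invariance of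
    \<open>popt\<close>.\<close>
  have flow: "popt $ i * P $ i $ j = Popt $ i $ j" for i j
    by (simp add: P pnz)
  have inv: "popt v* P = popt"
    by (simp add: vector_matrix_mult_def vec_eq_iff flow cols)
  have "stationary_distribution P q \<longleftrightarrow> q = popt" for q
  proof
    assume q: "stationary_distribution P q"
    then obtain k where k: "q = k *\<^sub>R popt"
      using invariant_vector_unique[OF st uni p inv] by (auto simp: stationary_distribution_def)
    then have "k * (\<Sum>i\<in>UNIV. popt $ i) = 1"
      using q by (simp add: stationary_distribution_def sum_distrib_left)
    then show "q = popt" by (simp add: k p1)
  next
    assume "q = popt"
    then show "stationary_distribution P q"
      using p by (simp add: stationary_distribution_def p1 inv less_imp_le)
  qed
  moreover have "stable_wp1 M X A" if "dtmc_process M X s0 P" for M :: "'w measure" and X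
    by (rule stable_wp1_of_negative_drift[OF assms(2) st uni p inv p1 _ that]) (use neg in \<open>simp add: flow\<close>)
  ultimately show ?thesis
    using pol st P_eq by blast
qed

end
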